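(* Let $m>2$ be an integer and let $h<m$ be a positive divisor of $m$ such that $m/h$ is even. Write $m=2e$. Put $q=2^m$, $\overline{D}=\{x^{2^h+1}: x\in\mathbb{F}_q^*\}$ (as a set, without repetition) and $$\mathcal{C}_{\overline{D}}=\left\{\left(\mathrm{Tr}(x d)\right)_{d\in \overline{D}}: x\in\mathbb{F}_q\right\}.$$ Then $\mathcal{C}_{\overline{D}}$ is a $\left[\frac{2^m-1}{2^h+1},\,m\right]$ binary linear code whose weight distribution is as follows: weight $0$ has multiplicity $1$; weight $\frac{2^{m-1}-(-1)^{\frac{e}{h}}2^{e-1}}{2^h+1}$ has multiplicity $\frac{(2^m-1)2^h}{2^h+1}$; weight $\frac{2^{m-1}+(-1)^{\frac{e}{h}}2^{e+h-1}}{2^h+1}$ has multiplicity $\frac{2^m-1}{2^h+1}$; and there are no codewords of any other weight.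
   Context: $\mathbb{F}_q$ is the finite field with $q=2^m$ elements, $\mathbb{F}_q^*$ its multiplicative group, and $\mathrm{Tr}:\mathbb{F}_q\to\mathbb{F}_2$ is the absolute trace. An $[n,k]$ binary linear code is a $k$-dimensional $\mathbb{F}_2$-subspace of $\mathbb{F}_2^n$; the (Hamming) weight of a codeword is its number of nonzero coordinates; the weight distribution records, for each $i$, the number of codewords of weight $i$ (the multiplicity of the weight $i$).
   Formalization: The case h = e (that is, m = 2h) is excluded: there the set D is the nonzero elements of the subfield with 2^e elements, the code has dimension e rather than m, and the second listed weight is 0, so the claim is false (e.g. m = 4, h = 2 would need dimension 4 at length 3). *)

theory Defs
  imports
    Complex_Main
    "HOL-Library.Cardinality"
    "HOL-Library.Z2"
    "HOL-Library.Function_Algebras"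
    "HOL-Number_Theory.Residues"
begin

text \<open>
  \<open>\<bbbF>\<^sub>2\<close> is the type \<^typ>\<open>bit\<close>. A word over \<open>\<bbbF>\<^sub>2\<close> whose coordinates are indexed by a finite
  set \<open>I\<close> is a function to \<^typ>\<open>bit\<close> that vanishes outside \<open>I\<close>; the length is \<open>card I\<close>.
\<close>

interpretation word: vector_space "\<lambda>(c::bit) (v::'i \<Rightarrow> bit) i. c * v i"
  by unfold_locales (auto simp: fun_eq_iff algebra_simps)

definition words :: "'i set \<Rightarrow> ('i \<Rightarrow> bit) set" where
  "words I = {v. \<forall>i. i \<notin> I \<longrightarrow> v i = 0}"

definition binary_linear_code :: "'i set \<Rightarrow> nat \<Rightarrow> nat \<Rightarrow> ('i \<Rightarrow> bit) set \<Rightarrow> bool" where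
  "binary_linear_code I n k C \<longleftrightarrow>
     finite I \<and> card I = n \<and> C \<subseteq> words I \<and> word.subspace C \<and> word.dim C = k"

definition hamming_weight :: "('i \<Rightarrow> bit) \<Rightarrow> nat" where
  "hamming_weight v = card {i. v i \<noteq> 0}"

definition weight_multiplicity :: "('i \<Rightarrow> bit) set \<Rightarrow> nat \<Rightarrow> nat" where
  "weight_multiplicity C w = card {c \<in> C. hamming_weight c = w}"

text \<open>
  The absolute trace of a field with \<open>2 ^ m\<close> elements: \<open>Tr x = x + x\<^sup>2 + x\<^sup>4 + \<dots> + x ^ 2 ^ (m - 1)\<close>,
  which lies in the prime field \<open>{0, 1}\<close> and is transported along its identification with \<^typ>\<open>bit\<close>.
\<close>

definition abs_trace :: "nat \<Rightarrow> 'a::finite_field \<Rightarrow> bit" where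
  "abs_trace m x = (THE b. of_bit b = (\<Sum>i<m. x ^ (2 ^ i)))"

lemma of_bit_abs_trace:
  fixes x :: "'a::finite_field"
  assumes card: "CARD('a) = 2 ^ m"
  shows "of_bit (abs_trace m x) = (\<Sum>i<m. x ^ (2 ^ i))"
proof -
  let ?s = "\<Sum>i<m. x ^ (2 ^ i)"
  have pr: "prime CHAR('a)"
    using prime_CHAR_semidom finite_imp_CHAR_pos[OF finite_class.finite_UNIV] by blast
  have "CHAR('a) dvd 2 ^ m"
    using CHAR_dvd_CARD[where 'a = 'a] card by simp
  then have char: "CHAR('a) = 2"
    using pr prime_dvd_power primes_dvd_imp_eq two_is_prime_nat by blast
  have "?s ^ 2 = (\<Sum>i<m. (x ^ (2 ^ i)) ^ 2)"
    using freshmans_dream_sum[where 'a = 'a] pr char by metis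
  also have "\<dots> = (\<Sum>i<m. x ^ (2 ^ Suc i))"
    by (simp flip: power_mult add: mult.commute)
  also have "\<dots> + x = ?s + x ^ (2 ^ m)"
    using sum.lessThan_Suc_shift[of "\<lambda>i. x ^ (2 ^ i)" m]
      sum.lessThan_Suc[of "\<lambda>i. x ^ (2 ^ i)" m] by (simp add: add.commute)
  also have "x ^ (2 ^ m) = x"
    using finite_field_power_card_eq_same[of x] card by simp
  finally have "?s ^ 2 = ?s" by simp
  then have "?s * (?s - 1) = 0"
    by (simp add: power2_eq_square algebra_simps)
  then have "?s = 0 \<or> ?s = 1" by auto
  then have "\<exists>b. of_bit b = ?s"
    by (metis even_zero odd_one of_bool_eq)
  moreover have "b = b'" if "of_bit b = ?s" "of_bit b' = ?s" for b b'
    using that by (cases b; cases b') (auto split: if_splits)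
  ultimately have "\<exists>!b. of_bit b = ?s" by blast
  then show ?thesis
    unfolding abs_trace_def by (rule theI')
qed

definition trace_code :: "nat \<Rightarrow> 'a::finite_field set \<Rightarrow> ('a \<Rightarrow> bit) set" where
  "trace_code m D = {(\<lambda>d. if d \<in> D then abs_trace m (x * d) else 0) | x. True}"

text \<open>
  Pitfall: if \<open>m = 2 * h\<close>, then \<open>x ^ (2 ^ h + 1)\<close> is the norm to the subfield with \<open>2 ^ h\<close> elements.
  The trace code of \<open>nonzero_powers h\<close> then has dimension \<open>h\<close> rather than \<open>m\<close>, and the weight
  \<open>(2 ^ (m - 1) - 2 ^ (m div 2 + h - 1)) / (2 ^ h + 1)\<close> is \<open>0\<close>. The two-weight distribution needs \<open>m \<noteq> 2 * h\<close>.
\<close>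

definition nonzero_powers :: "nat \<Rightarrow> 'a::finite_field set" where
  "nonzero_powers h = {x ^ (2 ^ h + 1) | x. x \<noteq> 0}"

end

theory Submission
  imports Defs "HOL-Computational_Algebra.Polynomial"
begin

text \<open>
  Put \<open>N = 2 ^ h + 1\<close>. Since \<open>y \<mapsto> y ^ N\<close> is \<open>N\<close>-to-one from the units onto \<open>D\<close>, the weight of the
  codeword of \<open>x\<close> is \<open>(2 ^ m - S) / (2 * N)\<close> with \<open>S = (\<Sum>y. (- 1) ^ Tr (x * y ^ N))\<close>. The exponent is a
  quadratic form that is trivial on its radical, so \<open>S\<^sup>2\<close> is \<open>2 ^ m\<close> times the size of the radical,
  which is \<open>2 ^ (2 * h)\<close> for \<open>x \<in> D\<close> and \<open>1\<close> for other \<open>x \<noteq> 0\<close>. The sign of \<open>S\<close> follows from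
  \<open>S \<equiv> 1\<close> and \<open>2 ^ h \<equiv> - 1\<close> modulo \<open>N\<close>.
\<close>

section \<open>Arithmetic in characteristic two\<close>

lemma CHAR_eq_2:
  assumes "CARD('a::finite_field) = 2 ^ m"
  shows "CHAR('a) = 2"
proof -
  have "prime CHAR('a)"
    using prime_CHAR_semidom finite_imp_CHAR_pos[OF finite_class.finite_UNIV] by blast
  moreover have "CHAR('a) dvd 2 ^ m"
    using CHAR_dvd_CARD[where 'a = 'a] assms by simp
  ultimately show ?thesis
    using prime_dvd_power primes_dvd_imp_eq two_is_prime_nat by blast
qed

lemma add_self_CHAR_2:
  assumes "CHAR('a::comm_ring_1) = 2"
  shows "x + x = (0::'a)"
  using of_nat_CHAR[where 'a = 'a] assms by (simp flip: mult_2)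

lemma frobenius_add:
  assumes "CHAR('a::comm_semiring_1) = 2"
  shows "(x + y :: 'a) ^ 2 ^ n = x ^ 2 ^ n + y ^ 2 ^ n"
  by (rule freshmans_dream'[of "2 ^ n" n]) (simp_all add: assms)

lemma power_2_power_inj:
  assumes "CHAR('a::idom) = 2"
  shows "inj (\<lambda>x::'a. x ^ 2 ^ n)"
proof (rule injI)
  fix x y :: 'a
  assume eq: "x ^ 2 ^ n = y ^ 2 ^ n"
  have "(x + y) ^ 2 ^ n = 0"
    using eq add_self_CHAR_2[OF assms] by (simp add: frobenius_add[OF assms])
  \<comment> \<open>A domain has no nilpotents, so \<open>x + y = 0\<close>; zero is rewritten as
    \<open>y + y\<close> so that cancellation gives \<open>x = y\<close>.\<close>
  then have "x + y = y + y"
    using add_self_CHAR_2[OF assms, of y] by simp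
  then show "x = y" by simp
qed

lemma power_2_power_fixed:
  fixes x :: "'a::monoid_mult"
  assumes "x ^ 2 ^ h = x" and "h dvd n"
  shows "x ^ 2 ^ n = x"
proof -
  obtain k where "n = h * k" using assms(2) by blast
  moreover have "x ^ 2 ^ (h * k) = x"
    by (induction k) (simp_all add: power_add power_mult assms(1))
  ultimately show ?thesis by simp
qed

section \<open>Roots of unity and fibres of power maps\<close>

lemma card_roots_of_unity_le:
  assumes "n > 0"
  shows "card {x::'a::idom. x ^ n = 1} \<le> n"
proof -
  let ?p = "monom 1 n - 1 :: 'a poly"
  have "coeff ?p n = 1" using assms by simp
  then have "?p \<noteq> 0" by (metis coeff_0 zero_neq_one)
  then have "card {x. poly ?p x = 0} \<le> degree ?p" by (rule card_poly_roots_bound)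
  also have "degree ?p \<le> n" by (intro degree_diff_le) (auto simp: degree_monom_le)
  finally show ?thesis by (simp add: poly_monom)
qed

lemma finite_field_power_card_minus_1:
  fixes x :: "'a::finite_field"
  assumes "x \<noteq> 0"
  shows "x ^ (CARD('a) - 1) = 1"
proof -
  have "x * x ^ (CARD('a) - 1) = x"
    using finite_field_power_card_eq_same[of x] finite_UNIV_card_ge_0[where 'a = 'a]
    by (simp flip: power_Suc)
  then show ?thesis using assms by simp
qed

text \<open>
  Every unit is a root of \<open>X ^ (CARD('a) - 1) - 1 = (X ^ n - 1) * (1 + X ^ n + \<dots> + X ^ (n * (k - 1)))\<close>
  with \<open>n * k = CARD('a) - 1\<close>, and the second factor has at most \<open>n * (k - 1)\<close> roots.
\<close>
lemma card_roots_of_unity: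
  assumes "n dvd CARD('a::finite_field) - 1"
  shows "card {x::'a. x ^ n = 1} = n"
proof -
  obtain k where k: "CARD('a) - 1 = n * k" using assms by blast
  have "CARD('a) > 1"
    using card_mono[of "UNIV :: 'a set" "{0, 1}"] by simp
  then have pos: "n > 0" "k > 0" using k by (auto intro: Nat.gr0I)
  let ?g = "\<Sum>i<k. monom 1 (n * i) :: 'a poly"
  have g: "poly ?g x = (\<Sum>i<k. (x ^ n) ^ i)" for x
    by (simp add: poly_sum poly_monom power_mult)
  have "poly ?g 0 = (\<Sum>i<k. if i = 0 then 1 else 0)"
    unfolding g using pos by (intro sum.cong) (auto simp: power_0_left)
  then have "poly ?g 0 = 1"
    using pos by (simp add: sum.delta)
  then have g0: "?g \<noteq> 0" by (metis poly_0 zero_neq_one)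
  have deg: "degree ?g \<le> n * (k - 1)"
    by (intro degree_sum_le) (auto intro!: order.trans[OF degree_monom_le])
  have "UNIV - {0} \<subseteq> {x::'a. x ^ n = 1} \<union> {x. poly ?g x = 0}"
  proof
    fix x :: 'a assume "x \<in> UNIV - {0}"
    then have "(x ^ n) ^ k = 1"
      using finite_field_power_card_minus_1[of x] k by (simp flip: power_mult)
    then have "(x ^ n - 1) * poly ?g x = 0"
      unfolding g using power_diff_1_eq[of "x ^ n" k] by simp
    then show "x \<in> {x. x ^ n = 1} \<union> {x. poly ?g x = 0}" by auto
  qed
  then have "card (UNIV - {0::'a}) \<le> card ({x::'a. x ^ n = 1} \<union> {x. poly ?g x = 0})"
    by (intro card_mono) auto
  also have "\<dots> \<le> card {x::'a. x ^ n = 1} + card {x. poly ?g x = 0}"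
    by (rule card_Un_le)
  also have "card {x. poly ?g x = 0} \<le> n * (k - 1)"
    using card_poly_roots_bound[OF g0] deg by linarith
  finally have "n * k \<le> card {x::'a. x ^ n = 1} + n * (k - 1)"
    using k by (simp add: card_Diff_singleton)
  moreover have "n * k = n + n * (k - 1)"
    using pos by (cases k) auto
  ultimately have "n \<le> card {x::'a. x ^ n = 1}" by linarith
  with card_roots_of_unity_le[OF pos(1), where 'a = 'a] show ?thesis by simp
qed

text \<open>The fibre through a unit \<open>y\<close> is the coset of \<open>y\<close> modulo the
  group of \<open>n\<close>-th roots of unity, which has order \<open>n\<close>.\<close>

lemma card_power_fiber:
  fixes y :: "'a::finite_field"
  assumes "n dvd CARD('a) - 1" and "y \<noteq> 0"
  shows "card {z. z ^ n = y ^ n} = n"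
proof -
  have "{z. z ^ n = y ^ n} = (\<lambda>z. y * z) ` {z. z ^ n = 1}"
  proof (intro equalityI subsetI)
    fix z assume "z \<in> {z. z ^ n = y ^ n}"
    then have "z = y * (z / y)" "(z / y) ^ n = 1"
      using assms(2) by (auto simp: power_divide)
    then show "z \<in> (\<lambda>z. y * z) ` {z. z ^ n = 1}" by blast
  qed (auto simp: power_mult_distrib)
  then have "card {z. z ^ n = y ^ n} = card {z::'a. z ^ n = 1}"
    using assms(2) by (simp add: card_image inj_on_def)
  then show ?thesis using card_roots_of_unity[OF assms(1)] by simp
qed

lemma sum_power_fibers:
  fixes f :: "'a::finite_field \<Rightarrow> int"
  assumes "n dvd CARD('a) - 1" and "n > 0"
  shows "(\<Sum>y\<in>UNIV - {0}. f (y ^ n)) = int n * (\<Sum>d\<in>(\<lambda>y. y ^ n) ` (UNIV - {0}). f d)"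
proof -
  have "(\<Sum>y\<in>UNIV - {0}. f (y ^ n))
    = (\<Sum>d\<in>(\<lambda>y. y ^ n) ` (UNIV - {0}). \<Sum>y\<in>{y \<in> UNIV - {0}. y ^ n = d}. f (y ^ n))"
    by (rule sum.image_gen) simp
  also have "\<dots> = (\<Sum>d\<in>(\<lambda>y. y ^ n) ` (UNIV - {0}). int n * f d)"
  proof (rule sum.cong[OF refl])
    fix d :: 'a assume "d \<in> (\<lambda>y. y ^ n) ` (UNIV - {0})"
    then obtain y where y: "y \<noteq> 0" "d = y ^ n" by blast
    \<comment> \<open>Since \<open>n > 0\<close>, the power \<open>0 ^ n\<close> is zero, so zero
      never lies in the fibre of a unit.\<close>
    then have "{z \<in> UNIV - {0}. z ^ n = d} = {z. z ^ n = y ^ n}"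
      using assms(2) by (auto simp: power_0_left)
    then show "(\<Sum>y\<in>{y \<in> UNIV - {0}. y ^ n = d}. f (y ^ n)) = int n * f d"
      using card_power_fiber[OF assms(1) y(1)] y by simp
  qed
  finally show ?thesis by (simp add: sum_distrib_left)
qed

section \<open>The additive character of the absolute trace\<close>

definition trace_char :: "nat \<Rightarrow> 'a::finite_field \<Rightarrow> int" where
  "trace_char m x = (if abs_trace m x = 0 then 1 else -1)"

text \<open>The trace is only known through its image under \<open>of_bit\<close>, so both sides are
  compared in the field; \<open>of_bit\<close> is injective, and additive because the characteristic
  is two.\<close>

lemma abs_trace_add:
  fixes x y :: "'a::finite_field"
  assumes "CARD('a) = 2 ^ m"
  shows "abs_trace m (x + y) = abs_trace m x + abs_trace m y"
proof -
  have char: "CHAR('a) = 2" using CHAR_eq_2[OF assms] .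
  have add: "(of_bit (a + b) :: 'a) = of_bit a + of_bit b" for a b
    using add_self_CHAR_2[OF char, of 1] by (cases a; cases b) simp_all
  have inj: "a = b" if "(of_bit a :: 'a) = of_bit b" for a b
    using that by (cases a; cases b) simp_all
  have "(of_bit (abs_trace m (x + y)) :: 'a) = of_bit (abs_trace m x) + of_bit (abs_trace m y)"
    unfolding of_bit_abs_trace[OF assms] by (simp add: frobenius_add[OF char] sum.distrib)
  then show ?thesis
    unfolding add[symmetric] by (rule inj)
qed

lemma abs_trace_eq_0_iff:
  fixes x :: "'a::finite_field"
  assumes "CARD('a) = 2 ^ m"
  shows "abs_trace m x = 0 \<longleftrightarrow> (\<Sum>i<m. x ^ 2 ^ i) = 0"
  unfolding of_bit_abs_trace[OF assms, symmetric] by (cases "abs_trace m x") simp_all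

lemma abs_trace_0:
  assumes "CARD('a) = 2 ^ m"
  shows "abs_trace m (0::'a::finite_field) = 0"
  using abs_trace_eq_0_iff[OF assms, of 0] by (simp add: power_0_left)

lemma abs_trace_power_2:
  fixes x :: "'a::finite_field"
  assumes card: "CARD('a) = 2 ^ m"
  shows "abs_trace m (x ^ 2) = abs_trace m x"
proof -
  \<comment> \<open>Squaring shifts the sum by one place. Adding \<open>x\<close> restores the first
    term and leaves the surplus last term \<open>x ^ 2 ^ m\<close>, which is again
    \<open>x\<close>.\<close>
  have "(\<Sum>i<m. (x ^ 2) ^ 2 ^ i) + x = (\<Sum>i<m. x ^ 2 ^ Suc i) + x"
    by (simp flip: power_mult)
  also have "\<dots> = (\<Sum>i<m. x ^ 2 ^ i) + x ^ 2 ^ m"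
    using sum.lessThan_Suc_shift[of "\<lambda>i. x ^ 2 ^ i" m]
      sum.lessThan_Suc[of "\<lambda>i. x ^ 2 ^ i" m] by (simp add: add.commute)
  also have "x ^ 2 ^ m = x"
    using finite_field_power_card_eq_same[of x] card by simp
  finally have "(\<Sum>i<m. (x ^ 2) ^ 2 ^ i) = (\<Sum>i<m. x ^ 2 ^ i)" by simp
  then show ?thesis by (simp add: abs_trace_def)
qed

lemma abs_trace_power_2_power:
  fixes x :: "'a::finite_field"
  assumes "CARD('a) = 2 ^ m"
  shows "abs_trace m (x ^ 2 ^ n) = abs_trace m x"
  by (induction n) (simp_all add: power_mult abs_trace_power_2[OF assms] mult.commute[of 2])

text \<open>The upper half of the trace sum repeats the lower half, and equal halves cancel in
  characteristic two.\<close>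

lemma abs_trace_subfield:
  fixes x :: "'a::finite_field"
  assumes "CARD('a) = 2 ^ (2 * e)" and "x ^ 2 ^ e = x"
  shows "abs_trace (2 * e) x = 0"
proof -
  have "(\<Sum>i<2 * e. x ^ 2 ^ i) = (\<Sum>i<e. x ^ 2 ^ i) + (\<Sum>i<e. x ^ 2 ^ (e + i))"
    by (simp add: mult_2 lessThan_atLeast0 sum.atLeastLessThan_concat[of 0 e "e + e", symmetric]
      sum.shift_bounds_nat_ivl[of _ 0 e e, simplified] add.commute)
  also have "(\<Sum>i<e. x ^ 2 ^ (e + i)) = (\<Sum>i<e. x ^ 2 ^ i)"
    by (simp add: power_add power_mult assms(2))
  finally show ?thesis
    by (simp add: abs_trace_eq_0_iff[OF assms(1)] add_self_CHAR_2[OF CHAR_eq_2[OF assms(1)]])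
qed

lemma trace_char_0:
  assumes "CARD('a) = 2 ^ m"
  shows "trace_char m (0::'a::finite_field) = 1"
  by (simp add: trace_char_def abs_trace_0[OF assms])

lemma trace_char_add:
  fixes x y :: "'a::finite_field"
  assumes "CARD('a) = 2 ^ m"
  shows "trace_char m (x + y) = trace_char m x * trace_char m y"
  unfolding trace_char_def abs_trace_add[OF assms]
  by (cases "abs_trace m x"; cases "abs_trace m y") simp_all

text \<open>Otherwise the trace polynomial, of degree at most \<open>2 ^ (m - 1)\<close>, would
  vanish on all \<open>2 ^ m\<close> field elements.\<close>

lemma trace_char_nontrivial:
  assumes card: "CARD('a::finite_field) = 2 ^ m"
  shows "\<exists>x::'a. trace_char m x = -1"
proof (rule ccontr)
  assume "\<nexists>x::'a. trace_char m x = -1"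
  then have zero: "(\<Sum>i<m. x ^ 2 ^ i) = 0" for x :: 'a
    using abs_trace_eq_0_iff[OF card, of x] by (metis trace_char_def)
  have "m > 0"
    using card card_mono[of "UNIV :: 'a set" "{0, 1}"] by (cases m) auto
  then obtain n where m: "m = Suc n" by (cases m) auto
  let ?p = "\<Sum>i<m. monom 1 (2 ^ i) :: 'a poly"
  \<comment> \<open>Only the term with \<open>i = 0\<close> is linear, so the linear coefficient
    shows that the polynomial is not zero.\<close>
  have "coeff ?p 1 = (\<Sum>i<m. if i = 0 then 1 else 0)"
    by (simp only: coeff_sum, intro sum.cong) auto
  then have "coeff ?p 1 = 1" using \<open>m > 0\<close> by (simp add: sum.delta)
  then have "?p \<noteq> 0" by (metis coeff_0 zero_neq_one)
  then have "card {x. poly ?p x = 0} \<le> degree ?p" by (rule card_poly_roots_bound)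
  also have "degree ?p \<le> 2 ^ n"
    by (intro degree_sum_le) (auto simp: m intro!: order.trans[OF degree_monom_le])
  finally show False
    using zero card by (simp add: poly_sum poly_monom m)
qed

text \<open>Orthogonality: for \<open>w \<noteq> 0\<close>, translating \<open>y\<close> by
  \<open>c / w\<close> with \<open>trace_char m c = -1\<close> turns the sum into its
  negative.\<close>

lemma sum_trace_char:
  fixes w :: "'a::finite_field"
  assumes card: "CARD('a) = 2 ^ m"
  shows "(\<Sum>y\<in>UNIV. trace_char m (y * w)) = (if w = 0 then 2 ^ m else 0)"
proof (cases "w = 0")
  case True
  then show ?thesis using card by (simp add: trace_char_0[OF card])
next
  case False
  obtain c :: 'a where c: "trace_char m c = -1"
    using trace_char_nontrivial[OF card] by blast
  have "(\<Sum>y\<in>UNIV. trace_char m (y * w)) = (\<Sum>y\<in>UNIV. trace_char m ((y + c / w) * w))"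
    by (rule sum.reindex_bij_witness[of _ "\<lambda>y. y + c / w" "\<lambda>y. y - c / w"]) auto
  also have "\<dots> = (\<Sum>y\<in>UNIV. - trace_char m (y * w))"
    using False c by (simp add: distrib_right trace_char_add[OF card])
  finally show ?thesis using False by (simp add: sum_negf)
qed

section \<open>Dimension of a finite binary code from its cardinality\<close>

text \<open>The only scalars are 0 and 1, so adjoining \<open>b\<close> to an independent set adds
  one disjoint translate of the span and doubles it.\<close>

lemma word_card_span:
  fixes B :: "('i \<Rightarrow> bit) set"
  assumes "finite B" and "word.independent B"
  shows "finite (word.span B) \<and> card (word.span B) = 2 ^ card B"
  using assms
proof (induction B rule: finite_induct)
  case empty
  show ?case unfolding word.span_empty by simp
next
  case (insert b B)
  let ?S = "word.span B" and ?T = "(\<lambda>v. v + b) ` word.span B"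
  have b: "b \<notin> ?S" and ind: "word.independent B"
    using insert.prems insert.hyps(2) by (metis word.independent_insert)+
  have IH: "finite ?S" "card ?S = 2 ^ card B"
    using insert.IH[OF ind] by auto
  have scale: "(\<lambda>i. 0 * b i) = 0" "(\<lambda>i. 1 * b i) = b" by (auto simp: fun_eq_iff)
  have bb: "v - b + b = v" for v :: "'i \<Rightarrow> bit" by simp
  have "word.span (insert b B) = ?S \<union> ?T"
  proof (intro equalityI subsetI)
    fix v assume "v \<in> word.span (insert b B)"
    then obtain k where k: "v - (\<lambda>i. k * b i) \<in> ?S"
      unfolding word.span_insert by blast
    show "v \<in> ?S \<union> ?T"
    proof (cases "k = 0")
      case True
      then have "v - 0 \<in> ?S" using k by (simp only: scale)
      then show ?thesis by simp
    next
      case False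
      then have "k = 1" by simp
      then have "v - b \<in> ?S" using k by (simp only: scale)
      then show ?thesis using bb[of v] by (metis UnI2 imageI)
    qed
  next
    fix v assume "v \<in> ?S \<union> ?T"
    then have "v - (\<lambda>i. 0 * b i) \<in> ?S \<or> v - (\<lambda>i. 1 * b i) \<in> ?S"
      unfolding scale by auto
    then show "v \<in> word.span (insert b B)"
      unfolding word.span_insert by blast
  qed
  moreover have "?S \<inter> ?T = {}"
  proof -
    have False if "v \<in> ?S" "v + b \<in> ?S" for v
      using word.span_diff[OF that(2,1)] b by simp
    then show ?thesis by auto
  qed
  moreover have "card ?T = card ?S" by (simp add: card_image inj_on_def)
  ultimately show ?case
    using IH insert.hyps by (simp add: card_Un_disjoint)
qed

lemma word_dim_eq:
  fixes C :: "('i \<Rightarrow> bit) set"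
  assumes "word.subspace C" and "finite C" and "card C = 2 ^ k"
  shows "word.dim C = k"
proof -
  obtain B where B: "B \<subseteq> C" "word.independent B" "C \<subseteq> word.span B" "card B = word.dim C"
    using word.basis_exists by blast
  have "word.span B = C"
    using B assms(1) word.span_minimal by (metis subset_antisym)
  then have "(2::nat) ^ word.dim C = 2 ^ k"
    using word_card_span[of B] B assms finite_subset by metis
  then show ?thesis by simp
qed

section \<open>Character sums over powers\<close>

definition power_char_sum :: "nat \<Rightarrow> nat \<Rightarrow> 'a::finite_field \<Rightarrow> int" where
  "power_char_sum m n x = (\<Sum>y\<in>UNIV. trace_char m (x * y ^ n))"

text \<open>The term \<open>y = 0\<close> contributes 1 and every value on the units is taken
  \<open>n\<close> times. This links the sum to codeword weights and also shows that it is 1 modulo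
  \<open>n\<close>.\<close>

lemma power_char_sum_conv_image:
  fixes x :: "'a::finite_field"
  assumes card: "CARD('a) = 2 ^ m" and n: "n dvd 2 ^ m - 1" "n > 0"
  shows "power_char_sum m n x
    = 1 + int n * (\<Sum>d\<in>(\<lambda>y. y ^ n) ` (UNIV - {0}). trace_char m (x * d))"
proof -
  have "power_char_sum m n x = trace_char m (x * 0 ^ n) + (\<Sum>y\<in>UNIV - {0}. trace_char m (x * y ^ n))"
    unfolding power_char_sum_def by (rule sum.remove) simp_all
  moreover have "trace_char m (x * 0 ^ n) = 1"
    using n(2) by (simp add: power_0_left trace_char_0[OF card])
  ultimately show ?thesis
    using sum_power_fibers[of n "\<lambda>d. trace_char m (x * d)"] n card by simp
qed

lemma nonzero_powers_eq_image:
  "nonzero_powers h = (\<lambda>x::'a::finite_field. x ^ (2 ^ h + 1)) ` (UNIV - {0})"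
  by (auto simp: nonzero_powers_def)

lemma card_nonzero_powers:
  assumes "CARD('a::finite_field) = 2 ^ m" and "2 ^ h + 1 dvd (2 ^ m - 1 :: nat)"
  shows "(2 ^ h + 1) * card (nonzero_powers h :: 'a set) = 2 ^ m - 1"
proof -
  \<comment> \<open>Counting is summation of the constant function 1 along the fibres.\<close>
  have "(\<Sum>y\<in>UNIV - {0::'a}. 1) = int (2 ^ h + 1) * (\<Sum>d\<in>(nonzero_powers h :: 'a set). 1)"
    unfolding nonzero_powers_eq_image by (rule sum_power_fibers) (use assms in auto)
  then have "int (card (UNIV - {0::'a})) = int ((2 ^ h + 1) * card (nonzero_powers h :: 'a set))"
    by (simp only: sum_constant of_nat_mult mult_1_right)
  then show ?thesis
    unfolding of_nat_eq_iff using assms(1) by (simp add: card_Diff_singleton)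
qed

section \<open>Divisibility by \<open>2 ^ h + 1\<close> and the radical of the quadratic
  form\<close>

lemma two_power_double: "2 ^ (2 * h) = (2 ^ h * 2 ^ h :: 'a::comm_semiring_1)"
  by (simp add: mult_2 power_add)

lemma dvd_two_power_minus_1:
  assumes "a dvd b"
  shows "(2 ^ a - 1 :: nat) dvd 2 ^ b - 1"
proof -
  obtain k where k: "b = a * k" using assms by blast
  have "(2 ^ a - 1 :: int) dvd (2 ^ a) ^ k - 1"
    by (simp add: power_diff_1_eq)
  then have "int (2 ^ a - 1) dvd int (2 ^ b - 1)"
    by (simp add: k power_mult of_nat_diff)
  then show ?thesis by (simp only: int_dvd_int_iff)
qed

lemma two_power_plus_1_mult:
  "(2 ^ h + 1) * (2 ^ h - 1) = (2 ^ (2 * h) - 1 :: nat)"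
proof -
  have "int ((2 ^ h + 1) * (2 ^ h - 1)) = int (2 ^ (2 * h) - 1)"
    unfolding two_power_double by (simp add: of_nat_diff algebra_simps)
  then show ?thesis by (simp only: of_nat_eq_iff)
qed

lemma two_power_plus_1_dvd:
  assumes "2 * h dvd m"
  shows "2 ^ h + 1 dvd (2 ^ m - 1 :: nat)"
  using dvd_two_power_minus_1[OF assms] two_power_plus_1_mult dvd_mult_left by metis

text \<open>
  The \<open>u\<close> annihilated by the linearised polynomial \<open>x u + x ^ 2 ^ h * u ^ 2 ^ (2 * h)\<close> form the
  radical of the bilinear form of \<open>y \<mapsto> Tr (x * y ^ (2 ^ h + 1))\<close>.
\<close>
definition radical :: "nat \<Rightarrow> 'a::finite_field \<Rightarrow> 'a set" where
  "radical h x = {u. x * u + x ^ 2 ^ h * u ^ 2 ^ (2 * h) = 0}"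

text \<open>Multiplying the linearised polynomial by \<open>u ^ 2 ^ h\<close> gives
  \<open>c + c ^ 2 ^ h\<close> with \<open>c = x * u ^ (2 ^ h + 1)\<close>, which in characteristic
  two vanishes exactly when \<open>c ^ 2 ^ h = c\<close>.\<close>

lemma in_radical_iff:
  fixes x u :: "'a::finite_field"
  assumes char: "CHAR('a) = 2"
  shows "u \<in> radical h x \<longleftrightarrow> u = 0 \<or> (x * u ^ (2 ^ h + 1)) ^ 2 ^ h = x * u ^ (2 ^ h + 1)"
proof -
  let ?c = "x * u ^ (2 ^ h + 1)"
  have "(x * u + x ^ 2 ^ h * u ^ 2 ^ (2 * h)) * u ^ 2 ^ h = ?c + ?c ^ 2 ^ h"
    unfolding two_power_double
    by (simp add: algebra_simps power_mult_distrib flip: power_mult)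
  then have "x * u + x ^ 2 ^ h * u ^ 2 ^ (2 * h) = 0 \<longleftrightarrow> ?c + ?c ^ 2 ^ h = 0" if "u \<noteq> 0"
    using that by (metis mult_eq_0_iff power_not_zero)
  moreover have "?c + ?c ^ 2 ^ h = 0 \<longleftrightarrow> ?c ^ 2 ^ h = ?c"
    using add_self_CHAR_2[OF char, of ?c] by (metis add_left_cancel)
  ultimately show ?thesis
    by (cases "u = 0") (simp_all add: radical_def power_0_left)
qed

text \<open>A nonzero \<open>u\<close> in the radical makes \<open>c = x * u ^ (2 ^ h + 1)\<close> a
  fixed point of \<open>c \<mapsto> c ^ 2 ^ h\<close>. Such a point is itself a
  \<open>(2 ^ h + 1)\<close>-th power, hence so is \<open>x\<close>.\<close>

lemma radical_nonpower:
  fixes x :: "'a::finite_field"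
  assumes char: "CHAR('a) = 2" and "h > 0" and "x \<noteq> 0" and x: "x \<notin> nonzero_powers h"
  shows "radical h x = {0}"
proof -
  have False if u: "u \<noteq> 0" and c: "(x * u ^ (2 ^ h + 1)) ^ 2 ^ h = x * u ^ (2 ^ h + 1)" for u
  proof -
    define c where "c = x * u ^ (2 ^ h + 1)"
    \<comment> \<open>This is the square root of \<open>c\<close>, as
      \<open>b * b = c ^ 2 ^ h = c\<close>. Since also \<open>b ^ 2 ^ h = b\<close>, it follows that
      \<open>b ^ (2 ^ h + 1) = b * b = c\<close>.\<close>
    define b where "b = c ^ 2 ^ (h - 1)"
    have fix_c: "c ^ 2 ^ h = c" using c by (simp add: c_def)
    have "b ^ 2 ^ h = b" "b * b = c ^ (2 ^ (h - 1) * 2)"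
      unfolding b_def using fix_c by (metis power_mult mult.commute, simp add: power_mult power2_eq_square)
    moreover have "2 ^ (h - 1) * 2 = (2::nat) ^ h"
      using \<open>h > 0\<close> by (cases h) auto
    ultimately have "b ^ (2 ^ h + 1) = c" using fix_c by simp
    then have "x = (b / u) ^ (2 ^ h + 1)"
      using u unfolding power_divide by (simp add: c_def)
    moreover from this have "b / u \<noteq> 0" using \<open>x \<noteq> 0\<close> by auto
    ultimately show False using x unfolding nonzero_powers_def by blast
  qed
  then show ?thesis using in_radical_iff[OF char] by fastforce
qed

text \<open>With \<open>x = t ^ (2 ^ h + 1)\<close>, a nonzero \<open>u\<close> is in the radical
  iff \<open>t * u\<close> is a root of unity of order dividing \<open>2 ^ (2 * h) - 1\<close>; all
  of these lie in the field because \<open>2 * h dvd m\<close>.\<close>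

lemma card_radical_power:
  fixes x :: "'a::finite_field"
  assumes card: "CARD('a) = 2 ^ m" and "2 * h dvd m" and "h > 0" and x: "x \<in> nonzero_powers h"
  shows "card (radical h x) = 2 ^ (2 * h)"
proof -
  obtain t where t: "t \<noteq> 0" "x = t ^ (2 ^ h + 1)"
    using x by (auto simp: nonzero_powers_def)
  let ?R = "{v::'a. v ^ (2 ^ (2 * h) - 1) = 1}"
  have fixed: "(v ^ (2 ^ h + 1)) ^ 2 ^ h = v ^ (2 ^ h + 1) \<longleftrightarrow> v \<in> ?R" if "v \<noteq> 0" for v :: 'a
  proof -
    have "(2 ^ h + 1) * 2 ^ h = (2 ^ (2 * h) - 1) + (2 ^ h + 1 :: nat)"
      unfolding two_power_double by (simp add: algebra_simps)
    then have "(v ^ (2 ^ h + 1)) ^ 2 ^ h = v ^ (2 ^ (2 * h) - 1) * v ^ (2 ^ h + 1)"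
      by (metis power_add power_mult)
    then show ?thesis using that by auto
  qed
  have "radical h x = insert 0 ((\<lambda>v. v / t) ` ?R)"
  proof (intro equalityI subsetI)
    fix u assume "u \<in> radical h x"
    then have "u = 0 \<or> t * u \<in> ?R"
      using in_radical_iff[OF CHAR_eq_2[OF card], of u h x] fixed[of "t * u"] t
      by (auto simp: power_mult_distrib simp del: power_Suc)
    moreover have "u = (t * u) / t" using t by simp
    ultimately show "u \<in> insert 0 ((\<lambda>v. v / t) ` ?R)" by blast
  next
    fix u assume "u \<in> insert 0 ((\<lambda>v. v / t) ` ?R)"
    then consider "u = 0" | v where "u = v / t" "v \<in> ?R" by blast
    then show "u \<in> radical h x"
    proof cases
      case 1
      then show ?thesis using in_radical_iff[OF CHAR_eq_2[OF card]] by blast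
    next
      case 2
      have "x * u ^ (2 ^ h + 1) = v ^ (2 ^ h + 1)"
        using 2 t by (simp add: power_divide del: power_Suc)
      then show ?thesis
        using in_radical_iff[OF CHAR_eq_2[OF card], of u h x] fixed[of v] 2 by auto
    qed
  qed
  \<comment> \<open>Zero would satisfy the root equation only for exponent 0, which
    \<open>h > 0\<close> excludes.\<close>
  moreover have "0 \<notin> (\<lambda>v. v / t) ` ?R"
  proof
    assume "0 \<in> (\<lambda>v. v / t) ` ?R"
    then have "(0::'a) ^ (2 ^ (2 * h) - 1) = 1" using t by auto
    then have "(2::nat) ^ (2 * h) \<le> 1" by (auto simp: power_0_left split: if_splits)
    then show False using one_less_power[of "2::nat" "2 * h"] \<open>h > 0\<close> by simp
  qed
  moreover have "card ((\<lambda>v. v / t) ` ?R) = 2 ^ (2 * h) - 1"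
    using t card_roots_of_unity[of "2 ^ (2 * h) - 1", where 'a = 'a] dvd_two_power_minus_1[OF assms(2)] card
    by (simp add: card_image inj_on_def)
  ultimately show ?thesis by (simp add: card_insert_if)
qed

text \<open>
  Squaring and substituting \<open>z = y + u\<close> leaves, for each \<open>u\<close>, the sum over \<open>y\<close> of an additive
  character, which vanishes unless \<open>u\<close> lies in the radical.
\<close>
lemma power_char_sum_square:
  fixes x :: "'a::finite_field"
  assumes card: "CARD('a) = 2 ^ (2 * e)" and "h dvd e"
  shows "(power_char_sum (2 * e) (2 ^ h + 1) x)\<^sup>2 = 2 ^ (2 * e) * int (card (radical h x))"
proof -
  let ?chi = "trace_char (2 * e) :: 'a \<Rightarrow> int" and ?N = "2 ^ h + 1 :: nat"
  let ?L = "\<lambda>u. x * u + x ^ 2 ^ h * u ^ 2 ^ (2 * h)"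
  note char = CHAR_eq_2[OF card]
  have expand: "?chi (x * y ^ ?N) * ?chi (x * (y + u) ^ ?N) = ?chi (x * u ^ ?N) * ?chi (y ^ 2 ^ h * ?L u)"
    for y u
  proof -
    have "x * y ^ ?N + x * (y + u) ^ ?N
        = x * u ^ ?N + y ^ 2 ^ h * (x * u) + x * u ^ 2 ^ h * y + (x * y ^ ?N + x * y ^ ?N)"
      by (simp add: frobenius_add[OF char] algebra_simps)
    also have "x * y ^ ?N + x * y ^ ?N = 0" by (rule add_self_CHAR_2[OF char])
    finally have "?chi (x * y ^ ?N) * ?chi (x * (y + u) ^ ?N)
        = ?chi (x * u ^ ?N) * ?chi (y ^ 2 ^ h * (x * u)) * ?chi (x * u ^ 2 ^ h * y)"
      by (simp only: trace_char_add[OF card, symmetric] add_0_right)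
    \<comment> \<open>The trace is invariant under Frobenius; raising this argument to the power
      \<open>2 ^ h\<close> lets both terms linear in \<open>y\<close> share the factor
      \<open>y ^ 2 ^ h\<close>.\<close>
    also have "?chi (x * u ^ 2 ^ h * y) = ?chi ((x * u ^ 2 ^ h * y) ^ 2 ^ h)"
      by (simp only: trace_char_def abs_trace_power_2_power[OF card])
    also have "(x * u ^ 2 ^ h * y) ^ 2 ^ h = y ^ 2 ^ h * (x ^ 2 ^ h * u ^ 2 ^ (2 * h))"
      unfolding two_power_double by (simp add: power_mult_distrib flip: power_mult)
    finally show ?thesis
      by (simp only: trace_char_add[OF card] distrib_left mult.assoc)
  qed
  have inner: "(\<Sum>y\<in>UNIV. ?chi (y ^ 2 ^ h * w)) = (if w = 0 then 2 ^ (2 * e) else 0)" for w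
  proof -
    have "bij (\<lambda>y::'a. y ^ 2 ^ h)"
      using power_2_power_inj[OF char] finite_UNIV_inj_surj[OF finite_class.finite_UNIV]
      by (auto simp: bij_def)
    then have "(\<Sum>y\<in>UNIV. ?chi (y ^ 2 ^ h * w)) = (\<Sum>y\<in>UNIV. ?chi (y * w))"
      by (rule sum.reindex_bij_betw)
    then show ?thesis using sum_trace_char[OF card] by simp
  qed
  \<comment> \<open>On the radical the value is fixed by the power \<open>2 ^ h\<close>, hence by
    \<open>2 ^ e\<close> since \<open>h dvd e\<close>, and such elements have trace zero.\<close>
  have triv: "?chi (x * u ^ ?N) = 1" if "u \<in> radical h x" for u
  proof (cases "u = 0")
    case False
    then have "(x * u ^ ?N) ^ 2 ^ e = x * u ^ ?N"
      using that in_radical_iff[OF char] power_2_power_fixed[OF _ \<open>h dvd e\<close>] by blast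
    then show ?thesis by (simp only: trace_char_def abs_trace_subfield[OF card] if_True simp_thms)
  qed (simp add: trace_char_0[OF card])
  have "(power_char_sum (2 * e) ?N x)\<^sup>2 = (\<Sum>y\<in>UNIV. \<Sum>z\<in>UNIV. ?chi (x * y ^ ?N) * ?chi (x * z ^ ?N))"
    by (simp only: power_char_sum_def power2_eq_square sum_product)
  also have "\<dots> = (\<Sum>y\<in>UNIV. \<Sum>u\<in>UNIV. ?chi (x * y ^ ?N) * ?chi (x * (y + u) ^ ?N))"
  proof (rule sum.cong[OF refl])
    fix y :: 'a
    show "(\<Sum>z\<in>UNIV. ?chi (x * y ^ ?N) * ?chi (x * z ^ ?N))
        = (\<Sum>u\<in>UNIV. ?chi (x * y ^ ?N) * ?chi (x * (y + u) ^ ?N))"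
      by (rule sum.reindex_bij_witness[of _ "\<lambda>u. y + u" "\<lambda>z. z - y"]) auto
  qed
  also have "\<dots> = (\<Sum>u\<in>UNIV. \<Sum>y\<in>UNIV. ?chi (x * u ^ ?N) * ?chi (y ^ 2 ^ h * ?L u))"
    by (subst sum.swap) (simp only: expand)
  also have "\<dots> = (\<Sum>u\<in>UNIV. if u \<in> radical h x then 2 ^ (2 * e) else 0)"
    using triv by (intro sum.cong refl)
      (simp add: inner radical_def flip: sum_distrib_left del: power_Suc)
  also have "\<dots> = 2 ^ (2 * e) * int (card (radical h x))"
    by (simp add: sum.If_cases)
  finally show ?thesis .
qed

section \<open>Sign and value of the character sum\<close>

text \<open>Modulo \<open>2 ^ h + 1\<close> the power \<open>2 ^ (h * j)\<close> is
  \<open>(-1) ^ j\<close> while \<open>S\<close> is 1. The wrong sign would make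
  \<open>2 ^ h + 1\<close> divide 2, although it is at least 3.\<close>

lemma sign_of_square_root:
  fixes S :: int
  assumes sq: "S\<^sup>2 = 2 ^ (2 * (h * j))" and dvd: "2 ^ h + 1 dvd S - 1" and "h > 0"
  shows "S = (-1) ^ j * 2 ^ (h * j)"
proof -
  let ?s = "(-1) ^ j :: int"
  have "[2 ^ h = -1] (mod (2 ^ h + 1 :: int))"
    by (simp add: cong_iff_dvd_diff)
  then have "[(2 ^ h) ^ j = ?s] (mod (2 ^ h + 1))"
    by (rule cong_pow)
  then have s: "2 ^ h + 1 dvd 2 ^ (h * j) - ?s"
    by (simp add: cong_iff_dvd_diff power_mult)
  have "S\<^sup>2 = (2 ^ (h * j))\<^sup>2"
    using sq by (simp add: mult.commute flip: power_mult)
  then consider "S = 2 ^ (h * j)" | "S = - (2 ^ (h * j))"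
    by (auto simp: power2_eq_iff)
  then have "S = ?s * 2 ^ (h * j) \<or> 2 ^ h + 1 dvd (2::int)"
  proof cases
    case 1
    have "2 ^ h + 1 dvd (S - 1) - (2 ^ (h * j) - ?s)" using dvd s by (rule dvd_diff)
    then show ?thesis using 1 by (cases "even j") auto
  next
    case 2
    have "2 ^ h + 1 dvd (S - 1) + (2 ^ (h * j) - ?s)" using dvd s by (rule dvd_add)
    then show ?thesis using 2 by (cases "even j") auto
  qed
  moreover have "(2::int) ^ h \<ge> 2"
    using \<open>h > 0\<close> by (cases h) auto
  ultimately show ?thesis using zdvd_imp_le[of "2 ^ h + 1" 2] by auto
qed

lemma power_char_sum_value:
  fixes x :: "'a::finite_field"
  assumes card: "CARD('a) = 2 ^ (2 * e)" and "e = h * k" and "h > 0" and "x \<noteq> 0"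
  shows "power_char_sum (2 * e) (2 ^ h + 1) x
    = (if x \<in> nonzero_powers h then - ((-1) ^ k) * 2 ^ (e + h) else (-1) ^ k * 2 ^ e)"
proof -
  let ?S = "power_char_sum (2 * e) (2 ^ h + 1) x"
  have h: "h dvd e" "2 * h dvd 2 * e" using assms(2) by auto
  have N_pos: "2 ^ h + 1 > (0::nat)" by simp
  have "int (2 ^ h + 1) dvd ?S - 1"
    unfolding power_char_sum_conv_image[OF card two_power_plus_1_dvd[OF h(2)] N_pos]
    by (simp only: add_diff_cancel_left' dvd_triv_left)
  then have dvd: "2 ^ h + 1 dvd ?S - 1" by (simp only: of_nat_add of_nat_power of_nat_numeral of_nat_1)
  show ?thesis
  proof (cases "x \<in> nonzero_powers h")
    case True
    \<comment> \<open>The radical contributes the extra factor \<open>2 ^ (2 * h)\<close>, so the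
      exponent is \<open>k + 1\<close> instead of \<open>k\<close> and the sign flips.\<close>
    have "?S\<^sup>2 = 2 ^ (2 * (h * (k + 1)))"
      unfolding power_char_sum_square[OF card h(1)] card_radical_power[OF card h(2) \<open>h > 0\<close> True]
      by (simp add: assms(2) algebra_simps power_add)
    from sign_of_square_root[OF this dvd \<open>h > 0\<close>] show ?thesis
      using True by (simp add: assms(2) algebra_simps)
  next
    case False
    have "?S\<^sup>2 = 2 ^ (2 * (h * k))"
      unfolding power_char_sum_square[OF card h(1)]
        radical_nonpower[OF CHAR_eq_2[OF card] \<open>h > 0\<close> \<open>x \<noteq> 0\<close> False]
      by (simp add: assms(2))
    from sign_of_square_root[OF this dvd \<open>h > 0\<close>] show ?thesis
      using False by (simp add: assms(2))
  qed
qed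

section \<open>Codewords, their weights and multiplicities\<close>

definition trace_word :: "nat \<Rightarrow> 'a::finite_field set \<Rightarrow> 'a \<Rightarrow> 'a \<Rightarrow> bit" where
  "trace_word m D x = (\<lambda>d. if d \<in> D then abs_trace m (x * d) else 0)"

lemma trace_code_eq_range: "trace_code m D = range (trace_word m D)"
  by (auto simp: trace_code_def trace_word_def)

lemma trace_word_add:
  assumes "CARD('a::finite_field) = 2 ^ m"
  shows "trace_word m D (x + y :: 'a) = trace_word m D x + trace_word m D y"
  by (rule ext) (simp add: trace_word_def distrib_right abs_trace_add[OF assms])

lemma trace_word_0:
  assumes "CARD('a::finite_field) = 2 ^ m"
  shows "trace_word m D (0 :: 'a) = 0"
  by (rule ext) (simp add: trace_word_def abs_trace_0[OF assms])

lemma subspace_trace_code: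
  assumes card: "CARD('a::finite_field) = 2 ^ m"
  shows "word.subspace (trace_code m (D :: 'a set))"
proof (rule word.subspaceI)
  show zero: "0 \<in> trace_code m D"
    using rangeI[of "trace_word m D" 0] by (simp only: trace_code_eq_range trace_word_0[OF card])
  show "v + w \<in> trace_code m D" if vw: "v \<in> trace_code m D" "w \<in> trace_code m D" for v w
  proof -
    from vw obtain x y where "v = trace_word m D x" "w = trace_word m D y"
      unfolding trace_code_eq_range by blast
    then have "v + w = trace_word m D (x + y)" by (simp only: trace_word_add[OF card])
    then show ?thesis unfolding trace_code_eq_range by blast
  qed
  show "(\<lambda>i. c * v i) \<in> trace_code m D" if v: "v \<in> trace_code m D" for c v
  proof -
    have "(\<lambda>i. 0 * v i) = 0" "(\<lambda>i. 1 * v i) = v" by (auto simp: fun_eq_iff)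
    then show ?thesis using v zero by (cases c) simp_all
  qed
qed

text \<open>Each zero coordinate contributes 1 and each nonzero coordinate -1.\<close>

lemma hamming_weight_trace_word:
  fixes D :: "'a::finite_field set"
  shows "(\<Sum>d\<in>D. trace_char m (x * d)) = int (card D) - 2 * int (hamming_weight (trace_word m D x))"
proof -
  let ?A = "{d. abs_trace m (x * d) = 0}"
  have "{d. trace_word m D x d \<noteq> 0} = D \<inter> - ?A"
    by (auto simp: trace_word_def split: if_splits)
  then have w: "hamming_weight (trace_word m D x) = card (D \<inter> - ?A)"
    by (simp only: hamming_weight_def)
  have "(\<Sum>d\<in>D. trace_char m (x * d)) = int (card (D \<inter> ?A)) - int (card (D \<inter> - ?A))"
    unfolding trace_char_def by (subst sum.If_cases) simp_all
  moreover have "card D = card (D \<inter> ?A) + card (D \<inter> - ?A)"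
    using card_Un_disjoint[of "D \<inter> ?A" "D \<inter> - ?A"] by (simp add: Int_Un_distrib[symmetric] disjoint_iff)
  ultimately show ?thesis by (simp add: w)
qed

text \<open>Both expressions of the character sum are equated, with
  \<open>?N * card ?D = 2 ^ (2 * e) - 1\<close>. The result stays multiplied out over the integers
  to avoid division.\<close>

lemma weight_trace_word_nonzero_powers:
  fixes x :: "'a::finite_field"
  assumes card: "CARD('a) = 2 ^ (2 * e)" and e: "e = h * k" and "h > 0" and "x \<noteq> 0"
  shows "2 * (2 ^ h + 1) * int (hamming_weight (trace_word (2 * e) (nonzero_powers h) x))
    = 2 ^ (2 * e)
      - (if x \<in> nonzero_powers h then - ((-1) ^ k) * 2 ^ (e + h) else (-1) ^ k * 2 ^ e)"
proof -
  let ?D = "nonzero_powers h :: 'a set" and ?N = "2 ^ h + 1 :: nat"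
  have N: "?N dvd 2 ^ (2 * e) - 1" using e by (intro two_power_plus_1_dvd) simp
  have "power_char_sum (2 * e) ?N x = 1 + int ?N * (\<Sum>d\<in>?D. trace_char (2 * e) (x * d))"
    using power_char_sum_conv_image[OF card N] by (simp only: nonzero_powers_eq_image)
  also have "\<dots> = 1 + int (?N * card ?D)
      - 2 * int ?N * int (hamming_weight (trace_word (2 * e) ?D x))"
    unfolding hamming_weight_trace_word by (simp add: algebra_simps)
  also have "int (?N * card ?D) = 2 ^ (2 * e) - 1"
    unfolding card_nonzero_powers[OF card N] by (simp add: of_nat_diff)
  finally show ?thesis
    unfolding power_char_sum_value[OF card e \<open>h > 0\<close> \<open>x \<noteq> 0\<close>] by simp
qed

theorem corollary6:
  fixes m h e :: nat and D :: "'a::finite_field set"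
  assumes "CARD('a) = 2 ^ m"
    and "m > 2"
    and "h > 0" and "h < m" and "h dvd m"
    and "even (m div h)"
    and "m = 2 * e"
    and "h \<noteq> e"
    and "D = nonzero_powers h"
  shows "(2 ^ h + 1) dvd (2 ^ m - 1 :: nat)
    \<and> binary_linear_code D ((2 ^ m - 1) div (2 ^ h + 1)) m (trace_code m D)
    \<and> (\<exists>w1 w2 :: nat.
         real w1 = (2 ^ (m - 1) - (-1) ^ (e div h) * 2 ^ (e - 1)) / (2 ^ h + 1)
       \<and> real w2 = (2 ^ (m - 1) + (-1) ^ (e div h) * 2 ^ (e + h - 1)) / (2 ^ h + 1)
       \<and> distinct [0, w1, w2]
       \<and> weight_multiplicity (trace_code m D) 0 = 1
       \<and> real (weight_multiplicity (trace_code m D) w1) = (2 ^ m - 1) * 2 ^ h / (2 ^ h + 1)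
       \<and> real (weight_multiplicity (trace_code m D) w2) = (2 ^ m - 1) / (2 ^ h + 1)
       \<and> (\<forall>w. w \<notin> {0, w1, w2} \<longrightarrow> weight_multiplicity (trace_code m D) w = 0))"
proof -
  define k where "k = e div h"
  define c where "c = trace_word m D"
  let ?s = "(-1) ^ k :: int" and ?N = "2 ^ h + 1 :: nat"
  have card: "CARD('a) = 2 ^ (2 * e)" and "e > 0" using assms by auto
  obtain j where "m = h * (2 * j)"
    using assms(3,5,6) by (metis dvd_mult_div_cancel evenE)
  then have "e = h * j" using assms(7) by simp
  then have e: "e = h * k" using assms(3) by (simp add: k_def)
  \<comment> \<open>The case \<open>k = 1\<close> is \<open>h = e\<close>. Excluding it gives
    \<open>e + h < m\<close>, which later keeps \<open>w2\<close> away from zero.\<close>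
  then have "k \<noteq> 0" "k \<noteq> 1" using assms(8) \<open>e > 0\<close> by auto
  then have "h < e" using e assms(3) by simp
  have Ndvd: "?N dvd 2 ^ m - 1"
    using e assms(7) by (intro two_power_plus_1_dvd) simp
  have cardD: "?N * card D = 2 ^ m - 1"
    using card_nonzero_powers[OF assms(1) Ndvd] assms(9) by simp
  have cardD': "card D = (2 ^ m - 1) div ?N"
    unfolding cardD[symmetric] by (simp only: nonzero_mult_div_cancel_left add_is_0 one_neq_zero simp_thms)

  have weight: "2 * (2 ^ h + 1) * int (hamming_weight (c x))
      = 2 ^ m - (if x \<in> D then - ?s * 2 ^ (e + h) else ?s * 2 ^ e)"
    if "x \<noteq> 0" for x
    using weight_trace_word_nonzero_powers[OF card e assms(3) that]
    unfolding c_def assms(7,9) .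

  \<comment> \<open>The weight of a nonzero \<open>x\<close> depends only on whether
    \<open>x \<in> D\<close>, so one representative per class is chosen: 1 in \<open>D\<close>, and
    a unit \<open>x0\<close> outside, available because \<open>D\<close> is a proper fraction
    \<open>1 / ?N\<close> of the units.\<close>
  have "(1::'a) \<in> D" unfolding assms(9) nonzero_powers_def by (intro CollectI exI[of _ 1]) simp
  have D0: "D \<subseteq> UNIV - {0}" unfolding assms(9) nonzero_powers_def by auto
  have "card D * 1 < card D * ?N"
    using \<open>1 \<in> D\<close> by (intro mult_strict_left_mono) (auto simp: card_gt_0_iff)
  then have "card D < 2 ^ m - 1"
    by (simp only: mult.commute[of "card D"] cardD mult_1_left)
  then have "card D < card (UNIV - {0::'a})"
    using assms(1) by (simp add: card_Diff_singleton)
  then obtain x0 where x0: "x0 \<noteq> 0" "x0 \<notin> D"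
    using card_mono[of D "UNIV - {0}"] by (metis DiffE UNIV_I finite linorder_not_le singletonI subsetI)
  define w1 where "w1 = hamming_weight (c x0)"
  define w2 where "w2 = hamming_weight (c 1)"
  have w1: "2 * (2 ^ h + 1) * int w1 = 2 ^ m - ?s * 2 ^ e"
    using weight[OF x0(1)] x0(2) by (simp only: w1_def if_False)
  have w2: "2 * (2 ^ h + 1) * int w2 = 2 ^ m + ?s * 2 ^ (e + h)"
    using weight[of 1] \<open>1 \<in> D\<close> by (simp add: w2_def)
  have wt: "hamming_weight (c x) = (if x = 0 then 0 else if x \<in> D then w2 else w1)" for x
  proof (cases "x = 0")
    case True
    then show ?thesis
      using trace_word_0[OF assms(1)] by (simp add: c_def hamming_weight_def)
  next
    case False
    have "2 * (2 ^ h + 1) * int (hamming_weight (c x)) = 2 * (2 ^ h + 1) * int (if x \<in> D then w2 else w1)"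
      using weight[OF False] w1 w2 by (simp split: if_splits)
    moreover have "2 * (2 ^ h + 1) \<noteq> (0::int)" by (smt (verit) zero_less_power)
    ultimately have "int (hamming_weight (c x)) = int (if x \<in> D then w2 else w1)"
      by (simp only: mult_cancel_left simp_thms)
    then show ?thesis using False by simp
  qed

  have s: "?s = 1 \<or> ?s = -1" by (cases "even k") simp_all
  have pw: "(2::int) ^ e > 0" "(2::int) ^ e < 2 ^ m" "(2::int) ^ (e + h) > 0" "(2::int) ^ (e + h) < 2 ^ m"
    using \<open>h < e\<close> assms(7) by (simp_all add: power_strict_increasing)
  have s_bounds: "?s * a \<le> a" "- a \<le> ?s * a" if "a > 0" for a :: int
    using s that by (elim disjE; simp only:; linarith)+
  have w1_pos: "w1 \<noteq> 0"
  proof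
    assume "w1 = 0"
    then have "2 ^ m - ?s * 2 ^ e = 0" using w1 by (simp only: of_nat_0 mult_zero_right)
    then show False using s_bounds(1)[OF pw(1)] pw(2) by linarith
  qed
  have w2_pos: "w2 \<noteq> 0"
  proof
    assume "w2 = 0"
    then have "2 ^ m + ?s * 2 ^ (e + h) = 0" using w2 by (simp only: of_nat_0 mult_zero_right)
    then show False using s_bounds(2)[OF pw(3)] pw(4) by linarith
  qed
  have w12: "w1 \<noteq> w2"
  proof
    assume "w1 = w2"
    then have "?s * (2 ^ e + 2 ^ (e + h)) = 0" using w1 w2 by (simp add: algebra_simps)
    then show False using s pw by auto
  qed

  \<comment> \<open>The kernel of the additive map \<open>c\<close> is trivial because
    \<open>w1\<close> and \<open>w2\<close> are nonzero. Hence there are \<open>2 ^ m\<close>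
    codewords, and multiplicities can be counted on field elements.\<close>
  have inj: "inj c"
  proof (rule injI)
    fix x y assume "c x = c y"
    then have "c (x - y) = 0"
      unfolding c_def using trace_word_add[OF assms(1), of D "x - y" y] by simp
    then have "hamming_weight (c (x - y)) = 0" by (simp add: hamming_weight_def)
    then show "x = y" using wt[of "x - y"] w1_pos w2_pos by (simp split: if_splits)
  qed
  have code: "trace_code m D = range c"
    by (simp only: c_def trace_code_eq_range)
  have mult: "weight_multiplicity (trace_code m D) w = card {x. hamming_weight (c x) = w}" for w
  proof -
    have "{v \<in> range c. hamming_weight v = w} = c ` {x. hamming_weight (c x) = w}" by auto
    then show ?thesis
      using inj by (simp add: weight_multiplicity_def code card_image inj_on_subset)
  qed
  have mult0: "{x. hamming_weight (c x) = 0} = {0}"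
    using wt w1_pos w2_pos by auto
  have mult1: "{x. hamming_weight (c x) = w1} = UNIV - {0} - D"
    using wt w1_pos w12 by auto
  have mult2: "{x. hamming_weight (c x) = w2} = D"
    using wt w2_pos w12 D0 by auto
  have multn: "{x. hamming_weight (c x) = w} = {}" if "w \<notin> {0, w1, w2}" for w
    using wt that by auto

  have "real (?N * card D) = real (2 ^ m - 1)"
    by (simp only: cardD)
  then have realD: "(2 ^ h + 1) * real (card D) = 2 ^ m - 1"
    by (simp add: of_nat_diff distrib_right)
  have "card (UNIV - {0::'a} - D) = 2 ^ m - 1 - card D"
    using D0 assms(1) by (subst card_Diff_subset) (auto simp: card_Diff_singleton)
  moreover have "card D \<le> 2 ^ m - 1"
    unfolding cardD[symmetric] by simp
  ultimately have "real (card (UNIV - {0::'a} - D)) = real (2 ^ m - 1) - real (card D)"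
    by (simp only: of_nat_diff)
  then have real1: "real (card (UNIV - {0::'a} - D)) = 2 ^ m - 1 - real (card D)"
    by (simp add: of_nat_diff)

  have ne: "(2::real) ^ h + 1 \<noteq> 0"
    by (smt (verit) zero_less_power)
  have "binary_linear_code D ((2 ^ m - 1) div ?N) m (trace_code m D)"
    unfolding binary_linear_code_def
  proof (intro conjI)
    show "trace_code m D \<subseteq> words D"
      by (auto simp: trace_code_def words_def)
    show "word.dim (trace_code m D) = m"
    proof (rule word_dim_eq[OF subspace_trace_code[OF assms(1)]])
      show "finite (trace_code m D)" by (simp add: code)
      show "card (trace_code m D) = 2 ^ m"
        using inj assms(1) by (simp add: code card_image)
    qed
    show "word.subspace (trace_code m D)" by (rule subspace_trace_code[OF assms(1)])
  qed (simp_all add: cardD')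
  moreover have "real w1 = (2 ^ (m - 1) - (-1) ^ (e div h) * 2 ^ (e - 1)) / (2 ^ h + 1)"
  proof -
    have "real_of_int (2 * (2 ^ h + 1) * int w1) = real_of_int (2 ^ m - ?s * 2 ^ e)"
      by (simp only: w1)
    moreover have "(2::real) ^ m = 2 * 2 ^ (m - 1)" "(2::real) ^ e = 2 * 2 ^ (e - 1)"
      using assms(2) \<open>e > 0\<close> by (simp_all flip: power_Suc)
    ultimately have "2 * ((2 ^ h + 1) * real w1) = 2 * (2 ^ (m - 1) - (-1) ^ k * 2 ^ (e - 1))"
      by (simp add: algebra_simps)
    then have "real w1 * (2 ^ h + 1) = 2 ^ (m - 1) - (-1) ^ k * 2 ^ (e - 1)"
      by (simp only: mult_cancel_left mult.commute[of "real w1"]) simp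
    then show ?thesis
      unfolding k_def[symmetric] by (simp only: nonzero_eq_divide_eq[OF ne])
  qed
  moreover have "real w2 = (2 ^ (m - 1) + (-1) ^ (e div h) * 2 ^ (e + h - 1)) / (2 ^ h + 1)"
  proof -
    have "real_of_int (2 * (2 ^ h + 1) * int w2) = real_of_int (2 ^ m + ?s * 2 ^ (e + h))"
      by (simp only: w2)
    moreover have "(2::real) ^ m = 2 * 2 ^ (m - 1)" "(2::real) ^ (e + h) = 2 * 2 ^ (e + h - 1)"
      using assms(2) \<open>e > 0\<close> by (simp_all flip: power_Suc)
    ultimately have "2 * ((2 ^ h + 1) * real w2) = 2 * (2 ^ (m - 1) + (-1) ^ k * 2 ^ (e + h - 1))"
      by (simp add: algebra_simps)
    then have "real w2 * (2 ^ h + 1) = 2 ^ (m - 1) + (-1) ^ k * 2 ^ (e + h - 1)"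
      by (simp only: mult_cancel_left mult.commute[of "real w2"]) simp
    then show ?thesis
      unfolding k_def[symmetric] by (simp only: nonzero_eq_divide_eq[OF ne])
  qed
  moreover have "distinct [0, w1, w2]" using w1_pos w2_pos w12 by simp
  moreover have "weight_multiplicity (trace_code m D) 0 = 1"
    by (simp add: mult mult0)
  \<comment> \<open>The units outside \<open>D\<close> number
    \<open>(2 ^ h + 1) * card D - card D = 2 ^ h * card D\<close>.\<close>
  moreover have "real (weight_multiplicity (trace_code m D) w1) = (2 ^ m - 1) * 2 ^ h / (2 ^ h + 1)"
    unfolding mult mult1 real1 realD[symmetric]
    by (simp only: nonzero_eq_divide_eq[OF ne]) (simp add: algebra_simps)
  moreover have "real (weight_multiplicity (trace_code m D) w2) = (2 ^ m - 1) / (2 ^ h + 1)"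
    unfolding mult mult2 realD[symmetric]
    by (simp only: nonzero_mult_div_cancel_left[OF ne])
  moreover have "\<forall>w. w \<notin> {0, w1, w2} \<longrightarrow> weight_multiplicity (trace_code m D) w = 0"
    unfolding mult using multn by (metis card.empty)
  ultimately show ?thesis using Ndvd by blast
qed

end
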